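(* Let $\alpha,\beta,\gamma,\delta$ be complex numbers and let $n\ge 1$. Let $(a_{i,j})_{i\ge 0,\,j\ge 0}$ be a tableau of complex numbers satisfying \[\delta a_{i,j}=\alpha a_{i-1,j}+\beta a_{i-1,j-1}+\gamma a_{i,j-1}\quad\text{for all } i\ge 1,\ j\ge 1,\] together with the boundary conditions \[\beta a_{i,0}+\gamma a_{i+1,0}=0\quad\text{and}\quad \delta a_{i+1,n+1}-\alpha a_{i,n+1}=0\qquad\text{for all }1\le i\le n-1.\] Let $R=(a_{i,j})_{1\le i,j\le n}$ and, for $e\ge 1$, write $R^e=(a^{(e)}_{i,j})_{1\le i,j\le n}$. Define sequences $(\delta_e),(\alpha_e),(\beta_e),(\gamma_e)_{e\ge1}$ each satisfying the recurrence \[x_{e+1}=(\beta+\delta)x_e-(\beta\delta+\alpha\gamma)x_{e-1}\quad(e\ge 2),\] with initial values $\delta_1=\delta,\ \delta_2=\delta^2-\alpha\gamma$; $\alpha_1=\alpha,\ \alpha_2=\alpha(\delta+\beta)$; $\beta_1=\beta,\ \beta_2=\beta^2-\alpha\gamma$; $\gamma_1=\gamma,\ \gamma_2=\gamma(\beta+\delta)$. Then for every $e\ge 1$ and all $2\le i,j\le n$, \[\delta_e a^{(e)}_{i,j}=\alpha_e a^{(e)}_{i-1,j}+\beta_e a^{(e)}_{i-1,j-1}+\gamma_e a^{(e)}_{i,j-1}.\] *)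

theory Defs
  imports Complex_Main "Jordan_Normal_Form.Matrix"
begin

definition tableau_matrix :: "nat \<Rightarrow> (nat \<Rightarrow> nat \<Rightarrow> complex) \<Rightarrow> complex mat" where
  "tableau_matrix n a = mat n n (\<lambda>(i, j). a (i + 1) (j + 1))"

(* Entries of type mat are indexed from 0; entry uses row and column numbers starting at 1,
   so that entry (tableau_matrix n a) i j = a i j for 1 <= i, j <= n. *)
definition entry :: "complex mat \<Rightarrow> nat \<Rightarrow> nat \<Rightarrow> complex" where
  "entry A i j = A $$ (i - 1, j - 1)"

end

(* With P_e = delta_e U - alpha_e L and Q_e = beta_e L + gamma_e U, where U and L are the
   (n-1) x n matrices selecting rows 2..n and 1..n-1, the tableau relation together with the boundary
   conditions says P_1 R = W U and Q_1 R = W L for an (n-1) x (n-1) matrix W.  If P_e R^e = W^e U and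
   Q_e R^e = W^e L, then (delta P_e - alpha Q_e) R^e = W^e P_1 and (beta Q_e + gamma P_e) R^e = W^e Q_1,
   and a further factor R turns the right-hand sides into W^(e+1) U and W^(e+1) L.  So the relations
   persist for all e, with coefficients that satisfy P_(e+1) = delta P_e - alpha Q_e and
   Q_(e+1) = beta Q_e + gamma P_e.  Cayley-Hamilton for this system of trace beta + delta and
   determinant beta delta + alpha gamma yields the stated second-order recurrence. *)

theory Submission
  imports Defs
begin

(* x has rows and columns 0..m, and W is eliminated from P x = W U, Q x = W L. *)
definition intertwines ::
  "nat \<Rightarrow> 'a::comm_ring_1 \<Rightarrow> 'a \<Rightarrow> 'a \<Rightarrow> 'a \<Rightarrow> (nat \<Rightarrow> nat \<Rightarrow> 'a) \<Rightarrow> bool" where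
  "intertwines m \<alpha> \<beta> \<gamma> \<delta> x \<longleftrightarrow>
    (\<forall>i<m. \<delta> * x (Suc i) 0 - \<alpha> * x i 0 = 0 \<and> \<beta> * x i m + \<gamma> * x (Suc i) m = 0 \<and>
      (\<forall>j<m. \<delta> * x (Suc i) (Suc j) - \<alpha> * x i (Suc j) = \<beta> * x i j + \<gamma> * x (Suc i) j))"

text \<open>Each row of W, padded with a zero on the left, is a row of P' x; padded on the right, it
  is the same row of Q' x. Multiplying by \<open>y\<close> therefore applies W to the lower or the
  upper shift of \<open>y\<close>. The new coefficients are those of \<delta> P' - \<alpha> Q' and
  \<beta> Q' + \<gamma> P', which make W act on exactly the row combinations that the assumption on
  \<open>y\<close> controls.\<close>

lemma intertwines_mult:
  fixes x y :: "nat \<Rightarrow> nat \<Rightarrow> 'a::comm_ring_1"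
  assumes x: "intertwines m \<alpha>' \<beta>' \<gamma>' \<delta>' x" and y: "intertwines m \<alpha> \<beta> \<gamma> \<delta> y"
  shows "intertwines m (\<delta> * \<alpha>' + \<alpha> * \<beta>') (\<beta> * \<beta>' - \<gamma> * \<alpha>')
    (\<beta> * \<gamma>' + \<gamma> * \<delta>') (\<delta> * \<delta>' - \<alpha> * \<gamma>') (\<lambda>i j. \<Sum>k\<le>m. x i k * y k j)"
proof -
  define p where "p i k = \<delta>' * x (Suc i) k - \<alpha>' * x i k" for i k
  define q where "q i k = \<beta>' * x i k + \<gamma>' * x (Suc i) k" for i k
  \<comment> \<open>Row \<open>i\<close> of W consists of the values \<open>q i k\<close> for
    \<open>k < m\<close>.\<close>
  have p0: "p i 0 = 0" and qm: "q i m = 0" and pq: "\<And>k. k < m \<Longrightarrow> p i (Suc k) = q i k"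
    if "i < m" for i
    using x that by (auto simp: intertwines_def p_def q_def)
  have sum_p: "(\<Sum>k\<le>m. p i k * y k j) = (\<Sum>k<m. q i k * y (Suc k) j)" if "i < m" for i j
    using that by (simp add: sum.lessThan_Suc_shift p0 pq del: sum.lessThan_Suc
        flip: lessThan_Suc_atMost)
  have sum_q: "(\<Sum>k\<le>m. q i k * y k j) = (\<Sum>k<m. q i k * y k j)" if "i < m" for i j
    using that by (simp add: qm flip: lessThan_Suc_atMost)
  let ?z = "\<lambda>i j. \<Sum>k\<le>m. x i k * y k j"
  have P: "(\<delta> * \<delta>' - \<alpha> * \<gamma>') * ?z (Suc i) j - (\<delta> * \<alpha>' + \<alpha> * \<beta>') * ?z i j
      = (\<Sum>k<m. q i k * (\<delta> * y (Suc k) j - \<alpha> * y k j))" if "i < m" for i j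
  proof -
    have "(\<delta> * \<delta>' - \<alpha> * \<gamma>') * ?z (Suc i) j - (\<delta> * \<alpha>' + \<alpha> * \<beta>') * ?z i j
        = \<delta> * (\<Sum>k\<le>m. p i k * y k j) - \<alpha> * (\<Sum>k\<le>m. q i k * y k j)"
      unfolding sum_distrib_left sum_subtractf[symmetric]
      by (rule sum.cong) (simp_all add: p_def q_def algebra_simps)
    also have "\<dots> = (\<Sum>k<m. q i k * (\<delta> * y (Suc k) j - \<alpha> * y k j))"
      unfolding sum_p[OF that] sum_q[OF that] sum_distrib_left sum_subtractf[symmetric]
      by (rule sum.cong) (simp_all add: algebra_simps)
    finally show ?thesis .
  qed
  have Q: "(\<beta> * \<beta>' - \<gamma> * \<alpha>') * ?z i j + (\<beta> * \<gamma>' + \<gamma> * \<delta>') * ?z (Suc i) j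
      = (\<Sum>k<m. q i k * (\<beta> * y k j + \<gamma> * y (Suc k) j))" if "i < m" for i j
  proof -
    have "(\<beta> * \<beta>' - \<gamma> * \<alpha>') * ?z i j + (\<beta> * \<gamma>' + \<gamma> * \<delta>') * ?z (Suc i) j
        = \<beta> * (\<Sum>k\<le>m. q i k * y k j) + \<gamma> * (\<Sum>k\<le>m. p i k * y k j)"
      unfolding sum_distrib_left sum.distrib[symmetric]
      by (rule sum.cong) (simp_all add: p_def q_def algebra_simps)
    also have "\<dots> = (\<Sum>k<m. q i k * (\<beta> * y k j + \<gamma> * y (Suc k) j))"
      unfolding sum_p[OF that] sum_q[OF that] sum_distrib_left sum.distrib[symmetric]
      by (rule sum.cong) (simp_all add: algebra_simps)
    finally show ?thesis .
  qed
  \<comment> \<open>By \<open>P\<close> and \<open>Q\<close> all expressions are sums with the same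
    weights \<open>q i k\<close>, so each clause follows termwise from the same clause for
    \<open>y\<close>.\<close>
  show ?thesis
    unfolding intertwines_def
  proof (intro allI impI conjI)
    fix i j assume i: "i < m" and j: "j < m"
    show "(\<delta> * \<delta>' - \<alpha> * \<gamma>') * ?z (Suc i) (Suc j) - (\<delta> * \<alpha>' + \<alpha> * \<beta>') * ?z i (Suc j)
      = (\<beta> * \<beta>' - \<gamma> * \<alpha>') * ?z i j + (\<beta> * \<gamma>' + \<gamma> * \<delta>') * ?z (Suc i) j"
      unfolding P[OF i] Q[OF i] using y j by (simp add: intertwines_def)
  next
    fix i assume i: "i < m"
    show "(\<delta> * \<delta>' - \<alpha> * \<gamma>') * ?z (Suc i) 0 - (\<delta> * \<alpha>' + \<alpha> * \<beta>') * ?z i 0 = 0"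
      unfolding P[OF i] using y by (simp add: intertwines_def)
    show "(\<beta> * \<beta>' - \<gamma> * \<alpha>') * ?z i m + (\<beta> * \<gamma>' + \<gamma> * \<delta>') * ?z (Suc i) m = 0"
      unfolding Q[OF i] using y by (simp add: intertwines_def)
  qed
qed

text \<open>Index shifts and linear combinations preserve the recurrence, so agreement at 1 and 2
  propagates. This turns the second-order recurrences into the one-step rules produced by
  \<open>intertwines_mult\<close>.\<close>

lemma linear_recurrence_shift:
  fixes x y z :: "nat \<Rightarrow> 'a::comm_ring_1"
  assumes x: "\<And>e. e \<ge> 2 \<Longrightarrow> x (e + 1) = t * x e - d * x (e - 1)"
    and y: "\<And>e. e \<ge> 2 \<Longrightarrow> y (e + 1) = t * y e - d * y (e - 1)"
    and z: "\<And>e. e \<ge> 2 \<Longrightarrow> z (e + 1) = t * z e - d * z (e - 1)"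
    and init: "x 2 = p * y 1 + q * z 1" "x 3 = p * y 2 + q * z 2"
    and "e \<ge> 1"
  shows "x (Suc e) = p * y e + q * z e"
  using \<open>e \<ge> 1\<close>
proof (induction e rule: less_induct)
  case (less e)
  consider "e = 1" | "e = 2" | "e \<ge> 3" using less.prems by linarith
  then show ?case
  proof cases
    case 3
    then obtain k where k: "e = Suc (Suc k)" "k \<ge> 1"
      by (metis Suc_le_D Suc_le_mono numeral_3_eq_3 One_nat_def)
    have "x (Suc (Suc k)) = p * y (Suc k) + q * z (Suc k)" "x (Suc k) = p * y k + q * z k"
      using less.IH k by auto
    moreover have "x (Suc e) = t * x (Suc (Suc k)) - d * x (Suc k)"
      "y e = t * y (Suc k) - d * y k" "z e = t * z (Suc k) - d * z k"
      using x[of "Suc (Suc k)"] y[of "Suc k"] z[of "Suc k"] k by simp_all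
    ultimately show ?thesis by (simp only:) (simp add: algebra_simps)
  qed (use init in \<open>simp_all add: numeral_2_eq_2 numeral_3_eq_3\<close>)
qed

theorem theorem2p1:
  fixes \<alpha> \<beta> \<gamma> \<delta> :: complex
    and n :: nat
    and a :: "nat \<Rightarrow> nat \<Rightarrow> complex"
    and \<alpha>s \<beta>s \<gamma>s \<delta>s :: "nat \<Rightarrow> complex"
  assumes n: "n \<ge> 1"
    and tableau: "\<And>i j. i \<ge> 1 \<Longrightarrow> j \<ge> 1 \<Longrightarrow>
      \<delta> * a i j = \<alpha> * a (i - 1) j + \<beta> * a (i - 1) (j - 1) + \<gamma> * a i (j - 1)"
    and left_boundary: "\<And>i. 1 \<le> i \<Longrightarrow> i \<le> n - 1 \<Longrightarrow>
      \<beta> * a i 0 + \<gamma> * a (i + 1) 0 = 0"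
    and right_boundary: "\<And>i. 1 \<le> i \<Longrightarrow> i \<le> n - 1 \<Longrightarrow>
      \<delta> * a (i + 1) (n + 1) - \<alpha> * a i (n + 1) = 0"
    and \<delta>_rec: "\<And>e. e \<ge> 2 \<Longrightarrow>
      \<delta>s (e + 1) = (\<beta> + \<delta>) * \<delta>s e - (\<beta> * \<delta> + \<alpha> * \<gamma>) * \<delta>s (e - 1)"
    and \<alpha>_rec: "\<And>e. e \<ge> 2 \<Longrightarrow>
      \<alpha>s (e + 1) = (\<beta> + \<delta>) * \<alpha>s e - (\<beta> * \<delta> + \<alpha> * \<gamma>) * \<alpha>s (e - 1)"
    and \<beta>_rec: "\<And>e. e \<ge> 2 \<Longrightarrow>
      \<beta>s (e + 1) = (\<beta> + \<delta>) * \<beta>s e - (\<beta> * \<delta> + \<alpha> * \<gamma>) * \<beta>s (e - 1)"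
    and \<gamma>_rec: "\<And>e. e \<ge> 2 \<Longrightarrow>
      \<gamma>s (e + 1) = (\<beta> + \<delta>) * \<gamma>s e - (\<beta> * \<delta> + \<alpha> * \<gamma>) * \<gamma>s (e - 1)"
    and \<delta>_init: "\<delta>s 1 = \<delta>" "\<delta>s 2 = \<delta>^2 - \<alpha> * \<gamma>"
    and \<alpha>_init: "\<alpha>s 1 = \<alpha>" "\<alpha>s 2 = \<alpha> * (\<delta> + \<beta>)"
    and \<beta>_init: "\<beta>s 1 = \<beta>" "\<beta>s 2 = \<beta>^2 - \<alpha> * \<gamma>"
    and \<gamma>_init: "\<gamma>s 1 = \<gamma>" "\<gamma>s 2 = \<gamma> * (\<beta> + \<delta>)"
  shows "\<forall>e\<ge>1. \<forall>i\<in>{2..n}. \<forall>j\<in>{2..n}.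
    \<delta>s e * entry (tableau_matrix n a ^\<^sub>m e) i j =
      \<alpha>s e * entry (tableau_matrix n a ^\<^sub>m e) (i - 1) j
      + \<beta>s e * entry (tableau_matrix n a ^\<^sub>m e) (i - 1) (j - 1)
      + \<gamma>s e * entry (tableau_matrix n a ^\<^sub>m e) i (j - 1)"
proof (intro allI impI ballI)
  fix e i j :: nat assume e: "1 \<le> e" and i: "i \<in> {2..n}" and j: "j \<in> {2..n}"
  define m where "m = n - 1"
  have nm: "n = Suc m" using n by (simp add: m_def)
  let ?R = "tableau_matrix n a"
  have carrier: "?R ^\<^sub>m k \<in> carrier_mat n n" for k
    by (simp add: tableau_matrix_def pow_carrier_mat)
  have R_entry: "?R $$ (k, l) = a (Suc k) (Suc l)" if "k \<le> m" "l \<le> m" for k l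
    using that by (simp add: tableau_matrix_def nm)
  have R: "intertwines m \<alpha> \<beta> \<gamma> \<delta> (\<lambda>k l. a (Suc k) (Suc l))"
    unfolding intertwines_def
  proof (intro allI impI conjI)
    fix k l assume "k < m" "l < m"
    show "\<delta> * a (Suc (Suc k)) (Suc (Suc l)) - \<alpha> * a (Suc k) (Suc (Suc l))
      = \<beta> * a (Suc k) (Suc l) + \<gamma> * a (Suc (Suc k)) (Suc l)"
      using tableau[of "Suc (Suc k)" "Suc (Suc l)"] by simp
  next
    \<comment> \<open>In column 1 the left boundary condition cancels the \<beta> and \<gamma> terms
      of the tableau relation; in column n + 1 the right one cancels the \<delta> and \<alpha>
      terms, leaving a relation in column n.\<close>
    fix k assume k: "k < m"
    show "\<delta> * a (Suc (Suc k)) (Suc 0) - \<alpha> * a (Suc k) (Suc 0) = 0"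
      using tableau[of "Suc (Suc k)" 1] left_boundary[of "Suc k"] k nm by simp
    show "\<beta> * a (Suc k) (Suc m) + \<gamma> * a (Suc (Suc k)) (Suc m) = 0"
      using tableau[of "Suc (Suc k)" "Suc (Suc m)"] right_boundary[of "Suc k"] k nm
      by (simp add: algebra_simps)
  qed
  have x3: "x 3 = (\<beta> + \<delta>) * x 2 - (\<beta> * \<delta> + \<alpha> * \<gamma>) * x 1"
    if "\<And>e. e \<ge> 2 \<Longrightarrow> x (e + 1) = (\<beta> + \<delta>) * x e - (\<beta> * \<delta> + \<alpha> * \<gamma>) * x (e - 1)"
    for x :: "nat \<Rightarrow> complex"
    using that[of 2] by simp
  note inits = \<delta>_init \<alpha>_init \<beta>_init \<gamma>_init
  note thirds = x3[of \<delta>s, OF \<delta>_rec] x3[of \<alpha>s, OF \<alpha>_rec] x3[of \<beta>s, OF \<beta>_rec] x3[of \<gamma>s, OF \<gamma>_rec]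
  \<comment> \<open>The pairs (\<delta>s, \<gamma>s) and (\<alpha>s, \<beta>s) evolve by 2 x 2
    matrices that differ only in the signs of the off-diagonal entries, hence share trace and
    determinant.\<close>
  have coeff_step:
    "\<delta>s (Suc k) = \<delta> * \<delta>s k + (- \<alpha>) * \<gamma>s k" "\<alpha>s (Suc k) = \<delta> * \<alpha>s k + \<alpha> * \<beta>s k"
    "\<beta>s (Suc k) = \<beta> * \<beta>s k + (- \<gamma>) * \<alpha>s k" "\<gamma>s (Suc k) = \<beta> * \<gamma>s k + \<gamma> * \<delta>s k"
    if "k \<ge> 1" for k
       apply (rule linear_recurrence_shift[OF \<delta>_rec \<delta>_rec \<gamma>_rec _ _ that];
        simp add: inits thirds algebra_simps power2_eq_square del: One_nat_def)
      apply (rule linear_recurrence_shift[OF \<alpha>_rec \<alpha>_rec \<beta>_rec _ _ that];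
        simp add: inits thirds algebra_simps power2_eq_square del: One_nat_def)
     apply (rule linear_recurrence_shift[OF \<beta>_rec \<beta>_rec \<alpha>_rec _ _ that];
        simp add: inits thirds algebra_simps power2_eq_square del: One_nat_def)
    apply (rule linear_recurrence_shift[OF \<gamma>_rec \<gamma>_rec \<delta>_rec _ _ that];
        simp add: inits thirds algebra_simps power2_eq_square del: One_nat_def)
    done
  \<comment> \<open>The induction must carry the two edge clauses along with the interior relation,
    since \<open>intertwines_mult\<close> consumes them.\<close>
  have "intertwines m (\<alpha>s e) (\<beta>s e) (\<gamma>s e) (\<delta>s e) (\<lambda>k l. (?R ^\<^sub>m e) $$ (k, l))"
    using e
  proof (induction e rule: dec_induct)
    case base
    have "?R ^\<^sub>m 1 = ?R" by (simp add: tableau_matrix_def)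
    then show ?case
      using R by (simp add: intertwines_def R_entry inits[simplified])
  next
    case (step k)
    have mult: "(?R ^\<^sub>m Suc k) $$ (r, s) = (\<Sum>l\<le>m. (?R ^\<^sub>m k) $$ (r, l) * a (Suc l) (Suc s))"
      if "r \<le> m" "s \<le> m" for r s
    proof -
      have "(?R ^\<^sub>m Suc k) $$ (r, s) = (\<Sum>l<n. (?R ^\<^sub>m k) $$ (r, l) * ?R $$ (l, s))"
        using that carrier[of k] carrier[of 1]
        by (simp add: scalar_prod_def nm atLeast0LessThan)
      then show ?thesis
        using that by (simp add: nm lessThan_Suc_atMost R_entry[unfolded nm])
    qed
    have "intertwines m (\<alpha>s (Suc k)) (\<beta>s (Suc k)) (\<gamma>s (Suc k)) (\<delta>s (Suc k))
        (\<lambda>r s. \<Sum>l\<le>m. (?R ^\<^sub>m k) $$ (r, l) * a (Suc l) (Suc s))"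
      \<comment> \<open>The new factor R stands on the right, so its coefficients are the fixed
        unprimed ones.\<close>
      using intertwines_mult[OF step.IH R]
      by (simp add: coeff_step[OF step.hyps(1)])
    then show ?case by (simp add: intertwines_def mult del: pow_mat.simps)
  qed
  \<comment> \<open>\<open>entry\<close> lowers indices by one, so row i is \<open>Suc k\<close> and
    row i - 1 is \<open>k\<close>: the goal is the interior clause at \<open>k\<close>,
    \<open>l\<close>.\<close>
  moreover obtain k l where "i = Suc (Suc k)" "j = Suc (Suc l)" "k < m" "l < m"
    using i j nm by (auto dest!: le_Suc_ex)
  ultimately show "\<delta>s e * entry (?R ^\<^sub>m e) i j = \<alpha>s e * entry (?R ^\<^sub>m e) (i - 1) j
      + \<beta>s e * entry (?R ^\<^sub>m e) (i - 1) (j - 1) + \<gamma>s e * entry (?R ^\<^sub>m e) i (j - 1)"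
    by (simp add: intertwines_def entry_def algebra_simps)
qed

end
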